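(* $$\liminf_{n\to\infty}|\mathcal C_n(132,213)|^{1/n}\ \ge\ 1.23693.$$
   Context: $\mathcal C_n(132,213)$ is the set of permutations of $\{1,\dots,n\}$ that are cyclic (their cycle decomposition is a single cycle of length $n$) and whose one-line notation avoids both patterns $132$ and $213$. *)

theory Defs
  imports
    "HOL-Combinatorics.Orbits"
    "HOL-Library.Sublist"
    "HOL-Library.Extended_Real"
    "HOL-Library.Liminf_Limsup"
begin

definition one_line :: "nat \<Rightarrow> (nat \<Rightarrow> nat) \<Rightarrow> nat list" where
  "one_line n p = map p [1..<Suc n]"

definition order_isomorphic :: "nat list \<Rightarrow> nat list \<Rightarrow> bool" where
  "order_isomorphic v s \<longleftrightarrow>
     length v = length s \<and>
     (\<forall>i<length s. \<forall>j<length s. v ! i < v ! j \<longleftrightarrow> s ! i < s ! j)"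

text \<open>\<^const>\<open>subseq\<close> is the not necessarily contiguous subsequence relation, so
  this is classical (not consecutive) pattern containment.\<close>

definition avoids :: "nat list \<Rightarrow> nat list \<Rightarrow> bool" where
  "avoids w s \<longleftrightarrow> \<not> (\<exists>v. subseq v w \<and> order_isomorphic v s)"

text \<open>A permutation of \<open>{1..n}\<close> is a function \<open>nat \<Rightarrow> nat\<close> fixing everything outside
  \<open>{1..n}\<close>, so distinct permutations are distinct functions and \<^const>\<open>card\<close> counts them
  correctly.  \<^const>\<open>cyclic_on\<close> says that \<open>{1..n}\<close> is a single orbit, i.e. that the cycle
  decomposition is one cycle of length \<open>n\<close>; the identity on \<open>{1}\<close> qualifies, and the set
  is empty for \<open>n = 0\<close>.\<close>

definition cyclic_avoiders :: "nat \<Rightarrow> nat list set \<Rightarrow> (nat \<Rightarrow> nat) set" where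
  "cyclic_avoiders n S =
     {p. p permutes {1..n} \<and> cyclic_on p {1..n} \<and> (\<forall>s\<in>S. avoids (one_line n p) s)}"

end

theory Submission
  imports Defs
begin

text \<open>
  A composition \<open>c\<close> of \<open>n\<close> gives a permutation of \<open>{1..n}\<close>: reverse every block of \<open>c\<close> in place, then
  apply the reflection \<open>x \<mapsto> n + 1 - x\<close>. Its one-line notation cuts \<open>1, \<dots>, n\<close> into runs of
  consecutive increasing values and lists the runs in decreasing order, so it has neither a
  132 nor a 213, and distinct compositions give distinct permutations. It remains to find many
  compositions whose permutation is a single cycle; call those cyclic.

  The permutation is a product of two involutions. Join every position to its image under each of
  them: the permutation is cyclic exactly when the resulting graph is a single path. A first block of
  size 1 makes position 1 an end of that path, and there the path can be prolonged by surrounding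
  the composition with new blocks. Two ways of doing so suffice:

  \<^item> If \<open>(1, w)\<close> is cyclic, so is \<open>(2, w, 1)\<close>: the path grows by two vertices.
    Read backwards this is \<open>(1, rev w, 2)\<close> (\<open>cyclic_composition_one_snoc_two\<close>).
  \<^item> If \<open>(1, X, 1, Y)\<close> is cyclic and \<open>X\<close> and \<open>Y\<close> have the same sum, then the blocks of \<open>X\<close> and \<open>Y\<close>
    form a strand that runs from the outermost position to the innermost one and visits everything
    outside the middle. The second 1 can therefore be replaced by any \<open>w\<close> for which
    \<open>(1, w)\<close> is cyclic (\<open>cyclic_insert\<close>).

  The second operation is used with \<open>(X, Y)\<close> equal to \<open>(4 | 4)\<close>, \<open>(6 | 6)\<close>, \<open>(2, 4 | 6)\<close> and
  \<open>(6 | 2, 4)\<close>. The outermost blocks of the new \<open>w\<close> tell the five operations apart, so the number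
  \<open>t s\<close> of cyclic compositions \<open>(1, w)\<close> with \<open>w\<close> of sum \<open>s\<close> satisfies
  \<open>t (s + 12) \<ge> t (s + 10) + t (s + 4) + 3 * t s\<close> (\<open>card_tails_recurrence\<close>). Since
  \<open>L = 1.23693\<close> satisfies \<open>L ^ 12 \<le> L ^ 10 + L ^ 4 + 3\<close>, the numbers \<open>t s\<close> grow at least like \<open>L ^ s\<close>.
\<close>

section \<open>Reachability\<close>

text \<open>The number of steps may be 0, in contrast to \<^const>\<open>orbit\<close>.\<close>

definition reaches :: "('a \<Rightarrow> 'a) \<Rightarrow> 'a \<Rightarrow> 'a \<Rightarrow> bool" where
  "reaches f x y \<longleftrightarrow> (\<exists>k. (f ^^ k) x = y)"

lemma reaches_refl [simp]: "reaches f x x"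
  unfolding reaches_def by (rule exI[of _ 0]) simp

lemma reaches_step: "reaches f x (f x)"
  unfolding reaches_def by (rule exI[of _ 1]) simp

lemma reaches_trans: "reaches f x y \<Longrightarrow> reaches f y z \<Longrightarrow> reaches f x z"
  unfolding reaches_def by (metis comp_apply funpow_add)

lemma reaches_into: "reaches f x y \<Longrightarrow> reaches f x (f y)"
  using reaches_trans reaches_step by metis

lemma reaches_induct [consumes 1, case_names refl step]:
  assumes "reaches f x y" and "P x" and "\<And>z. reaches f x z \<Longrightarrow> P z \<Longrightarrow> P (f z)"
  shows "P y"
proof -
  have "P ((f ^^ k) x)" for k
    by (induction k) (use assms in \<open>auto simp: reaches_def\<close>)
  with assms(1) show ?thesis
    by (auto simp: reaches_def)
qed

text \<open>Here \<open>g\<close> simulates \<open>f\<close> through the encoding \<open>h\<close>, taking possibly many steps for one.\<close>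

lemma reaches_simulation:
  assumes "reaches f x y" "x \<in> S"
    and "\<And>z. z \<in> S \<Longrightarrow> f z \<in> S" "\<And>z. z \<in> S \<Longrightarrow> reaches g (h z) (h (f z))"
  shows "reaches g (h x) (h y)"
proof -
  have "y \<in> S \<and> reaches g (h x) (h y)"
    using assms(1)
  proof (induction rule: reaches_induct)
    case (step z)
    then show ?case
      using assms(3,4)[of z] reaches_trans[of g "h x" "h z" "h (f z)"] by blast
  qed (use assms(2) in simp)
  then show ?thesis ..
qed

lemma cyclic_on_iff_reaches:
  assumes "f permutes S" "finite S" "s \<in> S"
  shows "cyclic_on f S \<longleftrightarrow> (\<forall>x\<in>S. reaches f s x)"
proof -
  have perm: "permutation f"
    using assms permutation_permutes by blast
  have orbit: "x \<in> orbit f s \<longleftrightarrow> reaches f s x" for x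
    unfolding orbit_altdef_self_in[OF permutation_self_in_orbit[OF perm]] reaches_def by blast
  have "orbit f s \<subseteq> S"
    using assms by (simp add: permutes_orbit_subset)
  moreover have "cyclic_on f S \<longleftrightarrow> S = orbit f s"
    using orbit_cyclic_eq3[OF _ assms(3)] assms(3) unfolding cyclic_on_def by blast
  ultimately show ?thesis
    using orbit by auto
qed

section \<open>Permutations from compositions\<close>

fun block_reversal :: "nat list \<Rightarrow> nat \<Rightarrow> nat" where
  "block_reversal [] x = x"
| "block_reversal (a # c) x = (if x \<le> a then a + 1 - x else a + block_reversal c (x - a))"

text \<open>The blocks become runs \<open>a, a + 1, \<dots>\<close> of consecutive values, every run lying below the one before:
  \<open>[2, 1, 3]\<close> gives the one-line notation \<open>5 6 4 1 2 3\<close>. Up to the reflection \<open>x \<mapsto> n + 1 - x\<close>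
  this is \<^const>\<open>block_reversal\<close>, so the permutation is a product of two involutions.\<close>

definition reverse_layered :: "nat list \<Rightarrow> nat \<Rightarrow> nat" where
  "reverse_layered c x =
     (if x \<in> {1..sum_list c} then sum_list c + 1 - block_reversal c x else x)"

lemma position_cases:
  fixes x a :: nat
  obtains "x \<le> a" | y where "1 \<le> y" "x = a + y"
proof (cases "x \<le> a")
  case False
  then show thesis
    using that(2)[of "x - a"] by simp
qed (rule that(1))

lemma block_reversal_bounds:
  "1 \<le> x \<Longrightarrow> x \<le> sum_list c \<Longrightarrow> 1 \<le> block_reversal c x \<and> block_reversal c x \<le> sum_list c"
proof (induction c arbitrary: x)
  case (Cons a c)
  show ?case
  proof (rule position_cases[of x a])
    fix y assume "1 \<le> y" "x = a + y"
    with Cons.prems Cons.IH[of y] show ?thesis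
      by (simp add: trans_le_add2)
  qed (use Cons.prems in auto)
qed simp

lemma block_reversal_involution:
  "1 \<le> x \<Longrightarrow> x \<le> sum_list c \<Longrightarrow> block_reversal c (block_reversal c x) = x"
proof (induction c arbitrary: x)
  case (Cons a c)
  show ?case
  proof (rule position_cases[of x a])
    fix y assume "1 \<le> y" "x = a + y"
    with Cons show ?thesis
      using block_reversal_bounds[of y c] by auto
  qed (use Cons.prems in auto)
qed simp

lemma block_reversal_append:
  "1 \<le> x \<Longrightarrow> block_reversal (c @ d) x =
     (if x \<le> sum_list c then block_reversal c x
      else sum_list c + block_reversal d (x - sum_list c))"
  by (induction c arbitrary: x) auto

lemma block_reversal_rev:
  "1 \<le> x \<Longrightarrow> x \<le> sum_list c \<Longrightarrow>
     block_reversal (rev c) (sum_list c + 1 - x) = sum_list c + 1 - block_reversal c x"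
proof (induction c arbitrary: x)
  case (Cons a c)
  show ?case
  proof (rule position_cases[of x a])
    assume "x \<le> a"
    with Cons.prems show ?thesis
      by (auto simp: block_reversal_append sum_list_rev)
  next
    fix y assume y: "1 \<le> y" "x = a + y"
    then have "sum_list (a # c) + 1 - x = sum_list c + 1 - y"
      by simp
    with Cons y show ?thesis
      using block_reversal_bounds[of y c] by (simp add: block_reversal_append sum_list_rev)
  qed
qed simp

lemma block_reversal_eq_imp_eq:
  assumes "0 \<notin> set c" "0 \<notin> set d" "sum_list c = sum_list d"
    and "\<And>x. 1 \<le> x \<Longrightarrow> x \<le> sum_list c \<Longrightarrow> block_reversal c x = block_reversal d x"
  shows "c = d"
  using assms
proof (induction c arbitrary: d)
  case Nil
  then show ?case
    by (cases d) auto
next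
  case (Cons a c)
  then obtain b e where d: "d = b # e"
    by (cases d) auto
  have "a = b"
    using Cons.prems(4)[of 1] Cons.prems(1,2) d by (auto simp: Suc_le_eq split: if_splits)
  moreover have "c = e"
  proof (rule Cons.IH)
    fix x assume "1 \<le> x" "x \<le> sum_list c"
    then show "block_reversal c x = block_reversal e x"
      using Cons.prems(4)[of "x + a"] d \<open>a = b\<close> by auto
  qed (use Cons.prems d \<open>a = b\<close> in auto)
  ultimately show ?case
    using d by simp
qed

lemma reverse_layered_add_block_reversal:
  assumes "1 \<le> x" "x \<le> sum_list c"
  shows "reverse_layered c x + block_reversal c x = sum_list c + 1"
  using assms block_reversal_bounds[of x c] by (auto simp: reverse_layered_def)

lemma reverse_layered_permutes: "reverse_layered c permutes {1..sum_list c}"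
proof (rule bij_imp_permutes)
  have "inj_on (reverse_layered c) {1..sum_list c}"
  proof (rule inj_onI)
    fix x y assume xy: "x \<in> {1..sum_list c}" "y \<in> {1..sum_list c}" "reverse_layered c x = reverse_layered c y"
    then have "block_reversal c x = block_reversal c y"
      using block_reversal_bounds[of x c] block_reversal_bounds[of y c] by (auto simp: reverse_layered_def)
    with xy(1,2) show "x = y"
      using block_reversal_involution by (metis atLeastAtMost_iff)
  qed
  moreover have "reverse_layered c ` {1..sum_list c} \<subseteq> {1..sum_list c}"
  proof
    fix y assume "y \<in> reverse_layered c ` {1..sum_list c}"
    then obtain x where "x \<in> {1..sum_list c}" "y = reverse_layered c x"
      by blast
    then show "y \<in> {1..sum_list c}"
      using block_reversal_bounds[of x c] by (auto simp: reverse_layered_def)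
  qed
  ultimately show "bij_betw (reverse_layered c) {1..sum_list c} {1..sum_list c}"
    unfolding bij_betw_def using endo_inj_surj[of "{1..sum_list c}" "reverse_layered c"] by blast
qed (auto simp: reverse_layered_def)

lemma reverse_layered_inj:
  assumes "0 \<notin> set c" "0 \<notin> set d" "sum_list c = sum_list d" "reverse_layered c = reverse_layered d"
  shows "c = d"
proof (rule block_reversal_eq_imp_eq)
  fix x assume x: "1 \<le> x" "x \<le> sum_list c"
  have "reverse_layered c x = reverse_layered d x"
    using assms(4) by simp
  then show "block_reversal c x = block_reversal d x"
    using x assms(3) block_reversal_bounds[of x c] block_reversal_bounds[of x d]
    by (auto simp: reverse_layered_def)
qed (use assms(1-3) in simp_all)

section \<open>Pattern avoidance\<close>

text \<open>Only two positions of the same block are inverted by \<^const>\<open>block_reversal\<close>, and a reversal keeps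
  the sum of position and value constant on a block.\<close>

lemma block_reversal_descent:
  "1 \<le> x \<Longrightarrow> x < y \<Longrightarrow> y \<le> sum_list c \<Longrightarrow> block_reversal c y < block_reversal c x \<Longrightarrow>
     block_reversal c x + x = block_reversal c y + y"
proof (induction c arbitrary: x y)
  case (Cons a c)
  show ?case
  proof (rule position_cases[of x a])
    assume x: "x \<le> a"
    show ?thesis
      by (rule position_cases[of y a]) (use x Cons.prems in auto)
  next
    fix u assume u: "1 \<le> u" "x = a + u"
    obtain v where v: "u < v" "y = a + v"
    proof
      show "u < y - a" "y = a + (y - a)"
        using u Cons.prems(2) by simp_all
    qed
    with u Cons.prems Cons.IH[of u v] show ?thesis
      by simp
  qed
qed simp

text \<open>An ascent stays inside one run, so values and positions grow by the same amount. This
  excludes both patterns: in a 132 two ascents share their start, in a 213 they share their end,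
  and equal growth would put the two other entries in increasing order.\<close>

lemma reverse_layered_ascent:
  assumes "1 \<le> x" "x < y" "y \<le> sum_list c" "reverse_layered c x < reverse_layered c y"
  shows "reverse_layered c y + x = reverse_layered c x + y"
  using assms block_reversal_descent[of x y c]
    reverse_layered_add_block_reversal[of x c] reverse_layered_add_block_reversal[of y c] by linarith

lemma subseq_one_lineE:
  assumes "subseq v (one_line n p)" "length v = 3"
  obtains i j k where "1 \<le> i" "i < j" "j < k" "k \<le> n" "v = [p i, p j, p k]"
proof -
  obtain N where "v = nths (one_line n p) N"
    using assms(1) by (auto simp: subseq_conv_nths)
  moreover define u where "u = nths [1..<Suc n] N"
  ultimately have v: "v = map p u"
    by (simp only: one_line_def nths_map)
  have sorted: "sorted_wrt (<) u"
    unfolding u_def strict_sorted_iff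
    by (intro conjI sorted_nths distinct_nthsI) (simp_all del: upt_Suc)
  have range: "set u \<subseteq> {1..n}"
    using set_nths_subset[of "[1..<Suc n]" N] by (simp only: u_def set_upt) auto
  have "length u = 3"
    using assms(2) v by simp
  then obtain i j k where "u = [i, j, k]"
    by (auto simp: numeral_3_eq_3 length_Suc_conv)
  with sorted range v show thesis
    using that[of i j k] by auto
qed

lemma avoids_length_three:
  assumes "length s = 3"
    and "\<And>i j k. 1 \<le> i \<Longrightarrow> i < j \<Longrightarrow> j < k \<Longrightarrow> k \<le> n \<Longrightarrow> \<not> order_isomorphic [p i, p j, p k] s"
  shows "avoids (one_line n p) s"
  unfolding avoids_def
proof
  assume "\<exists>v. subseq v (one_line n p) \<and> order_isomorphic v s"
  then obtain v where v: "subseq v (one_line n p)" "order_isomorphic v s"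
    by blast
  moreover from v(2) have "length v = 3"
    using assms(1) by (simp add: order_isomorphic_def)
  ultimately show False
    using assms(2) by (elim subseq_one_lineE) auto
qed

lemma reverse_layered_avoids:
  "avoids (one_line (sum_list c) (reverse_layered c)) [1,3,2]" (is ?A)
  "avoids (one_line (sum_list c) (reverse_layered c)) [2,1,3]" (is ?B)
proof -
  show ?A
  proof (rule avoids_length_three)
    fix i j k assume "1 \<le> i" "i < j" "j < k" "k \<le> sum_list c"
    then have "\<not> (reverse_layered c i < reverse_layered c k \<and> reverse_layered c k < reverse_layered c j)"
      using reverse_layered_ascent[of i k c] reverse_layered_ascent[of i j c] by auto
    then show "\<not> order_isomorphic [reverse_layered c i, reverse_layered c j, reverse_layered c k] [1,3,2]"
      unfolding order_isomorphic_def by (auto simp: All_less_Suc numeral_3_eq_3)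
  qed simp
  show ?B
  proof (rule avoids_length_three)
    fix i j k assume "1 \<le> i" "i < j" "j < k" "k \<le> sum_list c"
    then have "\<not> (reverse_layered c j < reverse_layered c i \<and> reverse_layered c i < reverse_layered c k)"
      using reverse_layered_ascent[of i k c] reverse_layered_ascent[of j k c] by auto
    then show "\<not> order_isomorphic [reverse_layered c i, reverse_layered c j, reverse_layered c k] [2,1,3]"
      unfolding order_isomorphic_def by (auto simp: All_less_Suc numeral_3_eq_3)
  qed simp
qed

section \<open>Cyclic compositions\<close>

definition cyclic_composition :: "nat list \<Rightarrow> bool" where
  "cyclic_composition c \<longleftrightarrow> cyclic_on (reverse_layered c) {1..sum_list c}"

lemma cyclic_composition_iff:
  assumes "s \<in> {1..sum_list c}"
  shows "cyclic_composition c \<longleftrightarrow> (\<forall>x\<in>{1..sum_list c}. reaches (reverse_layered c) s x)"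
  unfolding cyclic_composition_def
  by (rule cyclic_on_iff_reaches[OF reverse_layered_permutes _ assms]) simp

lemma cyclic_composition_reaches:
  assumes "cyclic_composition c" "x \<in> {1..sum_list c}" "y \<in> {1..sum_list c}"
  shows "reaches (reverse_layered c) x y"
  using assms(1,3) cyclic_composition_iff[OF assms(2)] by simp

lemma reverse_layered_rev:
  assumes "x \<in> {1..sum_list c}"
  shows "reverse_layered (rev c) (sum_list c + 1 - x) = block_reversal c x"
proof -
  have "1 \<le> sum_list c + 1 - x" "sum_list c + 1 - x \<le> sum_list (rev c)"
    using assms by (auto simp: sum_list_rev)
  from reverse_layered_add_block_reversal[OF this] show ?thesis
    using assms block_reversal_rev[of x c] block_reversal_bounds[of x c]
    by (simp add: sum_list_rev)
qed

text \<open>With \<open>R\<close> the reflection and \<open>B\<close> the reversal of the blocks, \<open>c\<close> gives \<open>R \<circ> B\<close>, and \<open>rev c\<close> gives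
  \<open>R \<circ> (R \<circ> B \<circ> R) = R \<circ> (R \<circ> B) \<circ> R\<close>: the two permutations are conjugate under \<open>R\<close>.\<close>

lemma cyclic_composition_rev:
  assumes "cyclic_composition c" "c \<noteq> []" "0 \<notin> set c"
  shows "cyclic_composition (rev c)"
proof -
  let ?n = "sum_list c"
  have n: "?n \<ge> 1"
    using assms(2,3) by (cases c) auto
  have in_range: "reverse_layered c x \<in> {1..?n}" if "x \<in> {1..?n}" for x
    using permutes_in_image[OF reverse_layered_permutes] that by blast
  have mirror: "reverse_layered (rev c) (?n + 1 - x) = ?n + 1 - reverse_layered c x" if "x \<in> {1..?n}" for x
    using reverse_layered_rev[OF that] reverse_layered_add_block_reversal[of x c] that by simp
  have "reaches (reverse_layered (rev c)) ?n x" if x: "x \<in> {1..?n}" for x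
  proof -
    have "reaches (reverse_layered c) 1 (?n + 1 - x)"
      using x n by (intro cyclic_composition_reaches[OF assms(1)]) auto
    then have "reaches (reverse_layered (rev c)) (?n + 1 - 1) (?n + 1 - (?n + 1 - x))"
    proof (rule reaches_simulation[where S = "{1..?n}"])
      show "reaches (reverse_layered (rev c)) (?n + 1 - z) (?n + 1 - reverse_layered c z)" if "z \<in> {1..?n}" for z
        using mirror[OF that] reaches_step by metis
    qed (use n in_range in auto)
    then show ?thesis
      using x by simp
  qed
  then show ?thesis
    using cyclic_composition_iff[of ?n "rev c"] n by (simp add: sum_list_rev)
qed

lemma reverse_layered_middle:
  assumes "1 \<le> y" "y \<le> sum_list w"
  shows "reverse_layered (d @ w @ e) (sum_list d + y) + block_reversal w y = sum_list w + sum_list e + 1"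
  using assms reverse_layered_add_block_reversal[of "sum_list d + y" "d @ w @ e"]
  by (simp add: block_reversal_append)

lemma reverse_layered_right:
  assumes "1 \<le> y" "y \<le> sum_list e"
  shows "reverse_layered (d @ e) (sum_list d + y) + block_reversal e y = sum_list e + 1"
  using assms reverse_layered_add_block_reversal[of "sum_list d + y" "d @ e"]
  by (simp add: block_reversal_append)

text \<open>Let \<open>m\<close> be the sum of \<open>X\<close>. The middle of \<open>(1, X, 1, Y)\<close> consists of the positions \<open>m + 1\<close>
  and \<open>m + 2\<close>, exchanged by the reflection, and its permutation \<open>e\<close> sends \<open>m + 2\<close> back to \<open>m + 1\<close>. As \<open>e\<close> is cyclic, it leads from
  \<open>m + 1\<close> through all other positions and arrives at \<open>m + 2\<close> last. Widening the middle
  to hold \<open>(1, w)\<close> changes none of these steps; so the new permutation \<open>g\<close> leads from the first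
  middle position through all outer ones to the last middle position. But that is
  precisely the single step that the permutation \<open>f\<close> of \<open>(1, w)\<close> makes at its first position, and on the
  rest of the middle \<open>g\<close> is a shifted copy of \<open>f\<close>. Hence \<open>g\<close> inserts the outer positions into the
  cycle of \<open>f\<close>.\<close>

lemma cyclic_insert:
  assumes outer: "cyclic_composition (1 # X @ [1] @ Y)"
    and inner: "cyclic_composition (1 # w)"
    and sums: "sum_list X = sum_list Y"
  shows "cyclic_composition (1 # X @ w @ Y)"
proof -
  define m where "m = sum_list X"
  define n where "n = sum_list w"
  define e where "e = reverse_layered (1 # X @ [1] @ Y)"
  define f where "f = reverse_layered (1 # w)"
  define g where "g = reverse_layered (1 # X @ w @ Y)"
  \<comment> \<open>the place of the position \<open>x\<close> of \<open>(1, X, 1, Y)\<close> after the middle has grown from 2 to \<open>n + 1\<close>\<close>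
  define pos where "pos x = (if x \<le> m + 1 then x else x + n - 1)" for x
  have Y: "sum_list Y = m"
    using sums m_def by simp
  have outer_step: "g (pos x) = pos (e x)" if x: "x \<in> {1..2 * m + 2}" "x \<noteq> m + 2" for x
  proof (cases "x \<le> m + 1")
    case True
    have "1 \<le> block_reversal (1 # X) x" "block_reversal (1 # X) x \<le> m + 1"
      using block_reversal_bounds[of x "1 # X"] True x by (auto simp: m_def)
    moreover have "e x + block_reversal (1 # X) x = 2 * m + 3"
      using reverse_layered_add_block_reversal[of x "(1 # X) @ [1] @ Y"]
        block_reversal_append[of x "1 # X" "[1] @ Y"] True x Y
      by (simp add: e_def m_def del: block_reversal.simps)
    moreover have "g x + block_reversal (1 # X) x = 2 * m + n + 2"
      using reverse_layered_add_block_reversal[of x "(1 # X) @ w @ Y"]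
        block_reversal_append[of x "1 # X" "w @ Y"] True x Y
      by (simp add: g_def m_def n_def del: block_reversal.simps)
    ultimately show ?thesis
      using True by (simp add: pos_def)
  next
    case False
    define y where "y = x - (m + 2)"
    have y: "1 \<le> y" "y \<le> m" "x = m + 2 + y"
      using x False by (auto simp: y_def)
    have "1 \<le> block_reversal Y y" "block_reversal Y y \<le> m"
      using block_reversal_bounds[of y Y] Y y by auto
    moreover have "e x + block_reversal Y y = m + 1"
      using reverse_layered_right[of y Y "1 # X @ [1]"] Y y by (simp add: e_def m_def)
    moreover have "g (m + n + 1 + y) + block_reversal Y y = m + 1"
      using reverse_layered_right[of y Y "1 # X @ w"] Y y by (simp add: g_def m_def n_def ac_simps)
    moreover have "pos x = m + n + 1 + y"
      using y by (simp add: pos_def)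
    ultimately show ?thesis
      by (simp add: pos_def)
  qed
  have e_return: "e (m + 2) = m + 1"
    using reverse_layered_middle[of 1 "[1]" "1 # X" Y] Y by (simp add: e_def m_def)
  have outer_reaches: "reaches g (m + 1) (pos x)" if "x \<in> {1..2 * m + 2}" for x
  proof -
    have "reaches e (m + 1) x"
      unfolding e_def by (rule cyclic_composition_reaches[OF outer]) (use that Y in \<open>auto simp: m_def\<close>)
    then have "reaches g (m + 1) (pos x) \<and> x \<in> {1..2 * m + 2}"
    proof (induction rule: reaches_induct)
      case refl
      show ?case
        by (simp add: pos_def)
    next
      case (step z)
      have "e z \<in> {1..2 * m + 2}"
        using permutes_in_image[OF reverse_layered_permutes[of "1 # X @ [1] @ Y"], of z] step Y
        by (simp add: e_def m_def)
      moreover have "reaches g (m + 1) (pos (e z))"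
      proof (cases "z = m + 2")
        case True
        then show ?thesis
          unfolding True e_return by (simp add: pos_def)
      next
        case False
        then show ?thesis
          using step outer_step[of z] reaches_into by metis
      qed
      ultimately show ?case
        by simp
    qed
    then show ?thesis ..
  qed
  have inner_step: "g (m + x) = m + f x" if "x \<in> {2..n + 1}" for x
  proof -
    define y where "y = x - 1"
    have y: "1 \<le> y" "y \<le> n" "x = 1 + y"
      using that by (auto simp: y_def)
    then show ?thesis
      using reverse_layered_middle[of y w "1 # X" Y] reverse_layered_right[of y w "[1]"] Y
      by (simp add: f_def g_def m_def n_def)
  qed
  have f_one: "f 1 = n + 1"
    by (simp add: f_def n_def reverse_layered_def)
  have inner_reaches: "reaches g (m + 1) (m + x)" if "x \<in> {1..n + 1}" for x
  proof -
    have "reaches f 1 x"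
      unfolding f_def by (rule cyclic_composition_reaches[OF inner]) (use that in \<open>auto simp: n_def\<close>)
    then show ?thesis
    proof (rule reaches_simulation[where h = "\<lambda>z. m + z" and S = "{1..n + 1}"])
      fix z assume z: "z \<in> {1..n + 1}"
      show "f z \<in> {1..n + 1}"
        using permutes_in_image[OF reverse_layered_permutes[of "1 # w"], of z] z
        by (simp add: f_def n_def)
      show "reaches g (m + z) (m + f z)"
      proof (cases "z = 1")
        case True
        then show ?thesis
          using outer_reaches[of "m + 2"] unfolding True f_one by (simp add: pos_def add.commute)
      next
        case False
        then show ?thesis
          using z inner_step[of z] reaches_step[of g "m + z"] by simp
      qed
    qed simp
  qed
  have "reaches g (m + 1) x" if x: "x \<in> {1..2 * m + n + 1}" for x
  proof -
    consider "x \<le> m + 1" | "m + 1 < x" "x \<le> m + n + 1" | "m + n + 1 < x"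
      by linarith
    then show ?thesis
    proof cases
      case 1
      then show ?thesis
        using outer_reaches[of x] x by (simp add: pos_def)
    next
      case 2
      then show ?thesis
        using inner_reaches[of "x - m"] by (simp add: Suc_le_eq)
    next
      case 3
      then have "x + 1 - n \<in> {1..2 * m + 2}" "pos (x + 1 - n) = x"
        using x by (auto simp: pos_def)
      with outer_reaches[of "x + 1 - n"] show ?thesis
        by simp
    qed
  qed
  then show ?thesis
    using cyclic_composition_iff[of "m + 1" "1 # X @ w @ Y"] Y
    by (simp add: g_def m_def n_def mult_2 ac_simps)
qed

text \<open>The same idea with a detour of three steps: \<open>2 \<mapsto> n + 3 \<mapsto> 1 \<mapsto> n + 2\<close> replaces the step \<open>1 \<mapsto> n + 1\<close>
  of the permutation of \<open>(1, w)\<close>, where \<open>n\<close> is the sum of \<open>w\<close> and its positions are shifted by one.\<close>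

lemma cyclic_wrap:
  assumes inner: "cyclic_composition (1 # w)"
  shows "cyclic_composition (2 # w @ [1])"
proof -
  define n where "n = sum_list w"
  define f where "f = reverse_layered (1 # w)"
  define g where "g = reverse_layered (2 # w @ [1])"
  have f_one: "f 1 = n + 1"
    by (simp add: f_def n_def reverse_layered_def)
  have g_two: "g 2 = n + 3"
    by (simp add: g_def n_def reverse_layered_def)
  have g_one: "g 1 = n + 2"
    by (simp add: g_def n_def reverse_layered_def)
  have g_last: "g (n + 3) = 1"
    using reverse_layered_right[of 1 "[1]" "2 # w"] by (simp add: g_def n_def numeral_3_eq_3)
  have inner_step: "g (1 + x) = 1 + f x" if "x \<in> {2..n + 1}" for x
  proof -
    define y where "y = x - 1"
    have y: "1 \<le> y" "y \<le> n" "x = 1 + y"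
      using that by (auto simp: y_def)
    then show ?thesis
      using reverse_layered_middle[of y w "[2]" "[1]"] reverse_layered_right[of y w "[1]"]
      by (simp add: f_def g_def n_def)
  qed
  have last: "reaches g 2 (n + 3)"
    using reaches_step[of g 2] g_two by simp
  then have first: "reaches g 2 1"
    using reaches_into[of g 2 "n + 3"] g_last by simp
  have inner_reaches: "reaches g 2 (1 + x)" if "x \<in> {1..n + 1}" for x
  proof -
    have "reaches f 1 x"
      unfolding f_def by (rule cyclic_composition_reaches[OF inner]) (use that in \<open>auto simp: n_def\<close>)
    then have "reaches g (1 + 1) (1 + x)"
    proof (rule reaches_simulation[where h = "\<lambda>z. 1 + z" and S = "{1..n + 1}"])
      fix z assume z: "z \<in> {1..n + 1}"
      show "f z \<in> {1..n + 1}"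
        using permutes_in_image[OF reverse_layered_permutes[of "1 # w"], of z] z
        by (simp add: f_def n_def)
      show "reaches g (1 + z) (1 + f z)"
      proof (cases "z = 1")
        case True
        show ?thesis
          using reaches_into[OF first] unfolding True f_one g_one one_add_one
          by (simp add: add.commute)
      next
        case False
        then show ?thesis
          using z inner_step[of z] reaches_step[of g "1 + z"] by simp
      qed
    qed simp
    then show ?thesis
      unfolding one_add_one .
  qed
  have "reaches g 2 x" if x: "x \<in> {1..n + 3}" for x
  proof -
    consider "x = 1" | "2 \<le> x" "x \<le> n + 2" | "x = n + 3"
      using x by fastforce
    then show ?thesis
    proof cases
      case 2
      then show ?thesis
        using inner_reaches[of "x - 1"] by (simp add: Suc_le_eq)
    qed (use first last in auto)
  qed
  then show ?thesis
    using cyclic_composition_iff[of 2 "2 # w @ [1]"] by (simp add: g_def n_def ac_simps)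
qed

text \<open>The reversal brings the block of size 1 back to the front, so that the step can be repeated.\<close>

lemma cyclic_composition_one_snoc_two:
  assumes "cyclic_composition (1 # w)" "0 \<notin> set w"
  shows "cyclic_composition (1 # rev w @ [2])"
  using cyclic_composition_rev[OF cyclic_wrap[OF assms(1)]] assms(2) by simp

lemma cyclic_composition_by_orbit:
  assumes "successively (\<lambda>x y. reverse_layered c x = y) (s # xs)"
    and "sort (s # xs) = [1..<Suc (sum_list c)]"
  shows "cyclic_composition c"
proof -
  have "\<forall>y\<in>set (s # xs). reaches (reverse_layered c) s y"
    using assms(1)
  proof (induction xs rule: rev_induct)
    case (snoc y xs)
    have "reverse_layered c (last (s # xs)) = y" "successively (\<lambda>x y. reverse_layered c x = y) (s # xs)"
      using snoc.prems successively_append_iff[of _ "s # xs" "[y]"] by simp_all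
    then show ?case
      using snoc.IH reaches_into[of "reverse_layered c" s "last (s # xs)"] last_in_set[of "s # xs"] by auto
  qed simp
  moreover have "set (s # xs) = {1..sum_list c}"
    by (metis assms(2) set_sort set_upt atLeastLessThanSuc_atLeastAtMost)
  moreover from this have "s \<in> {1..sum_list c}"
    by auto
  ultimately show ?thesis
    using cyclic_composition_iff by blast
qed

text \<open>The first two start the recursion, one for each parity of the sum; the others are the
  admissible surroundings \<open>(1, X, 1, Y)\<close> of \<open>cyclic_insert\<close>. Each proof exhibits the cycle.\<close>

lemma small_cyclic_compositions:
  "cyclic_composition [1]"
  "cyclic_composition [1, 1]"
  "cyclic_composition [1, 4, 1, 4]"
  "cyclic_composition [1, 6, 1, 6]"
  "cyclic_composition [1, 2, 4, 1, 6]"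
  "cyclic_composition [1, 6, 1, 2, 4]"
proof -
  show "cyclic_composition [1]"
    by (rule cyclic_composition_by_orbit[of _ 1 "[]"])
      (simp_all add: reverse_layered_def upt_rec)
  show "cyclic_composition [1, 1]"
    by (rule cyclic_composition_by_orbit[of _ 1 "[2]"])
      (simp_all add: reverse_layered_def upt_rec)
  show "cyclic_composition [1, 4, 1, 4]"
    by (rule cyclic_composition_by_orbit[of _ 1 "[10, 4, 8, 2, 6, 5, 9, 3, 7]"])
      (simp_all add: reverse_layered_def upt_rec)
  show "cyclic_composition [1, 6, 1, 6]"
    by (rule cyclic_composition_by_orbit[of _ 1 "[14, 6, 12, 4, 10, 2, 8, 7, 13, 5, 11, 3, 9]"])
      (simp_all add: reverse_layered_def upt_rec)
  show "cyclic_composition [1, 2, 4, 1, 6]"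
    by (rule cyclic_composition_by_orbit[of _ 1 "[14, 6, 10, 2, 12, 4, 8, 7, 11, 3, 13, 5, 9]"])
      (simp_all add: reverse_layered_def upt_rec)
  show "cyclic_composition [1, 6, 1, 2, 4]"
    by (rule cyclic_composition_by_orbit[of _ 1 "[14, 4, 10, 6, 12, 2, 8, 7, 13, 3, 9, 5, 11]"])
      (simp_all add: reverse_layered_def upt_rec)
qed

section \<open>Counting\<close>

text \<open>The compositions \<open>(1, w)\<close> are represented by \<open>w\<close>, the part that the operations act on.\<close>

definition tails :: "nat \<Rightarrow> nat list set" where
  "tails s = {w. 0 \<notin> set w \<and> sum_list w = s \<and> cyclic_composition (1 # w)}"

lemma inj_on_reverse_layered_tails: "inj_on (\<lambda>w. reverse_layered (1 # w)) (tails s)"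
  by (rule inj_onI) (auto simp: tails_def dest!: reverse_layered_inj[rotated 3])

lemma finite_cyclic_avoiders: "finite (cyclic_avoiders n S)"
  by (rule finite_subset[OF _ finite_permutations[of "{1..n}"]]) (auto simp: cyclic_avoiders_def)

lemma reverse_layered_tails_subset:
  "(\<lambda>w. reverse_layered (1 # w)) ` tails s \<subseteq> cyclic_avoiders (Suc s) {[1,3,2],[2,1,3]}"
proof
  fix p assume "p \<in> (\<lambda>w. reverse_layered (1 # w)) ` tails s"
  then obtain w where w: "w \<in> tails s" "p = reverse_layered (1 # w)"
    by blast
  then have "sum_list (1 # w) = Suc s"
    by (simp add: tails_def)
  then show "p \<in> cyclic_avoiders (Suc s) {[1,3,2],[2,1,3]}"
    using w reverse_layered_permutes[of "1 # w"] reverse_layered_avoids[of "1 # w"]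
    by (simp only: cyclic_avoiders_def tails_def cyclic_composition_def) simp
qed

lemma finite_tails: "finite (tails s)"
  using finite_imageD[OF finite_subset[OF reverse_layered_tails_subset finite_cyclic_avoiders]
    inj_on_reverse_layered_tails] .

lemma card_tails_le: "card (tails s) \<le> card (cyclic_avoiders (Suc s) {[1,3,2],[2,1,3]})"
  by (rule card_inj_on_le[OF inj_on_reverse_layered_tails reverse_layered_tails_subset finite_cyclic_avoiders])

lemma snoc_two_in_tails: "w \<in> tails s \<Longrightarrow> rev w @ [2] \<in> tails (s + 2)"
  using cyclic_composition_one_snoc_two[of w] by (auto simp: tails_def sum_list_rev)

lemma insert_in_tails:
  assumes "w \<in> tails s" "cyclic_composition (1 # X @ [1] @ Y)"
    and "sum_list X = k" "sum_list Y = k" "0 \<notin> set X" "0 \<notin> set Y"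
  shows "X @ w @ Y \<in> tails (s + 2 * k)"
  using assms cyclic_insert[of X Y w] by (auto simp: tails_def)

text \<open>Each of the five operations is injective, and the first and last blocks of its result show which
  operation it was.\<close>

lemma card_tails_recurrence:
  "card (tails (s + 10)) + card (tails (s + 4)) + 3 * card (tails s) \<le> card (tails (s + 12))"
proof -
  let ?A = "(\<lambda>w. rev w @ [2]) ` tails (s + 10)"
  let ?B = "(\<lambda>w. [4] @ w @ [4]) ` tails (s + 4)"
  let ?C = "(\<lambda>w. [6] @ w @ [6]) ` tails s"
  let ?D = "(\<lambda>w. [2, 4] @ w @ [6]) ` tails s"
  let ?E = "(\<lambda>w. [6] @ w @ [2, 4]) ` tails s"
  have cards: "card ?A = card (tails (s + 10))" "card ?B = card (tails (s + 4))"
    "card ?C = card (tails s)" "card ?D = card (tails s)" "card ?E = card (tails s)"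
    by (auto intro!: card_image inj_onI)
  have ends: "?A \<subseteq> {v. last v = 2}" "?B \<subseteq> {v. hd v = 4 \<and> last v = 4}"
    "?C \<subseteq> {v. hd v = 6 \<and> last v = 6}" "?D \<subseteq> {v. hd v = 2 \<and> last v = 6}"
    "?E \<subseteq> {v. hd v = 6 \<and> last v = 4}"
    by auto
  have disjoint: "?A \<inter> ?B = {}" "(?A \<union> ?B) \<inter> ?C = {}" "(?A \<union> ?B \<union> ?C) \<inter> ?D = {}"
    "(?A \<union> ?B \<union> ?C \<union> ?D) \<inter> ?E = {}"
    using ends by force+
  have "?A \<subseteq> tails (s + 12)" "?B \<subseteq> tails (s + 12)" "?C \<subseteq> tails (s + 12)"
    "?D \<subseteq> tails (s + 12)" "?E \<subseteq> tails (s + 12)"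
    using snoc_two_in_tails[of _ "s + 10"]
      insert_in_tails[of _ "s + 4" "[4]" "[4]" 4] insert_in_tails[of _ s "[6]" "[6]" 6]
      insert_in_tails[of _ s "[2, 4]" "[6]" 6] insert_in_tails[of _ s "[6]" "[2, 4]" 6]
      small_cyclic_compositions
    by (auto simp: add.commute)
  then have "card (?A \<union> ?B \<union> ?C \<union> ?D \<union> ?E) \<le> card (tails (s + 12))"
    by (intro card_mono finite_tails) blast
  moreover have "card (?A \<union> ?B \<union> ?C \<union> ?D \<union> ?E) = card ?A + card ?B + card ?C + card ?D + card ?E"
    by (simp only: card_Un_disjoint disjoint finite_tails finite_imageI finite_UnI)
  ultimately show ?thesis
    using cards by linarith
qed

text \<open>This provides the twelve initial values that the recurrence needs.\<close>

lemma card_tails_pos: "card (tails s) \<ge> 1"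
proof -
  have "\<exists>w. w \<in> tails s"
  proof (induction s rule: induct_nat_012)
    case 0
    have "[] \<in> tails 0"
      using small_cyclic_compositions(1) by (simp add: tails_def)
    then show ?case ..
  next
    case 1
    have "[1] \<in> tails (Suc 0)"
      using small_cyclic_compositions(2) by (simp add: tails_def)
    then show ?case ..
  next
    case (ge2 s)
    then show ?case
      using snoc_two_in_tails[of _ s] by auto
  qed
  then have "card (tails s) \<noteq> 0"
    using finite_tails by (metis card_0_eq empty_iff)
  then show ?thesis
    by simp
qed

text \<open>The factor \<open>1.23693 ^ 12\<close> makes the claim follow from \<open>card_tails_pos\<close> for \<open>s < 12\<close>; from there on
  the recurrence carries it because \<open>1.23693\<close> lies below the positive root of
  \<open>x ^ 12 = x ^ 10 + x ^ 4 + 3\<close>.\<close>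

lemma power_le_card_tails: "(1.23693 :: real) ^ s \<le> 1.23693 ^ 12 * card (tails s)"
proof (induction s rule: less_induct)
  case (less s)
  define L where "L = (1.23693 :: real)"
  have L: "L > 1" "L ^ 12 \<le> L ^ 10 + L ^ 4 + 3"
    by (simp_all add: L_def power_divide)
  show ?case
    unfolding L_def[symmetric]
  proof (cases "s < 12")
    case True
    have "L ^ s \<le> L ^ 12 * 1"
      using L(1) True by (simp add: power_increasing)
    also have "\<dots> \<le> L ^ 12 * card (tails s)"
      using L(1) card_tails_pos[of s] by (intro mult_left_mono) auto
    finally show "L ^ s \<le> L ^ 12 * card (tails s)" .
  next
    case False
    then obtain t where t: "s = t + 12"
      by (metis le_Suc_ex add.commute not_less)
    have "L ^ s = L ^ t * L ^ 12"
      by (simp add: t power_add)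
    also have "\<dots> \<le> L ^ t * (L ^ 10 + L ^ 4 + 3)"
      using L by (intro mult_left_mono) auto
    also have "\<dots> = L ^ (t + 10) + L ^ (t + 4) + 3 * L ^ t"
      by (simp add: power_add algebra_simps)
    also have "\<dots> \<le> L ^ 12 * card (tails (t + 10)) + L ^ 12 * card (tails (t + 4))
        + 3 * (L ^ 12 * card (tails t))"
      unfolding L_def by (intro add_mono mult_left_mono less.IH) (simp_all add: t)
    also have "\<dots> = L ^ 12 * real (card (tails (t + 10)) + card (tails (t + 4)) + 3 * card (tails t))"
      by (simp add: algebra_simps)
    also have "\<dots> \<le> L ^ 12 * card (tails s)"
      using L(1) card_tails_recurrence[of t] unfolding t
      by (intro mult_left_mono of_nat_mono) auto
    finally show "L ^ s \<le> L ^ 12 * card (tails s)" .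
  qed
qed

theorem theorem4p5:
  shows "liminf (\<lambda>n. ereal (root n (real (card (cyclic_avoiders n {[1,3,2],[2,1,3]})))))
           \<ge> ereal 1.23693"
proof -
  define L where "L = (1.23693 :: real)"
  have L: "L > 0"
    by (simp add: L_def)
  let ?C = "\<lambda>n. card (cyclic_avoiders n {[1,3,2],[2,1,3]})"
  \<comment> \<open>12 factors \<open>L\<close> come from the initial values, and one from the block in front of \<open>w\<close>\<close>
  have "(\<lambda>n. L / root n (L ^ 13)) \<longlonglongrightarrow> L / 1"
    using L by (intro tendsto_intros LIMSEQ_root_const) auto
  then have "liminf (\<lambda>n. ereal (L / root n (L ^ 13))) = ereal L"
    by (intro lim_imp_Liminf) auto
  moreover have "L / root n (L ^ 13) \<le> root n (?C n)" if n: "n \<ge> 1" for n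
  proof -
    obtain s where s: "n = Suc s"
      using n by (cases n) auto
    have "L ^ s \<le> L ^ 12 * ?C n"
      using power_le_card_tails[of s] card_tails_le[of s] L unfolding s L_def
      by (meson mult_left_mono of_nat_mono order_trans zero_le_power less_imp_le)
    then have "L ^ n / L ^ 13 \<le> ?C n"
      using L by (simp add: s field_simps eval_nat_numeral)
    then have "root n (L ^ n / L ^ 13) \<le> root n (?C n)"
      using n by simp
    then show ?thesis
      using L n by (simp add: real_root_divide real_root_power_cancel)
  qed
  then have "liminf (\<lambda>n. ereal (L / root n (L ^ 13))) \<le> liminf (\<lambda>n. ereal (root n (?C n)))"
    by (intro Liminf_mono eventually_sequentiallyI[of 1]) simp
  ultimately show ?thesis
    by (simp add: L_def)
qed

end
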